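(* For all integers $n,k\ge0$ we have $\mathrm{rpc}_+^k(n)=\mathrm{pc}_+^k(n)/2^k$, $\mathrm{rpc}_-^k(n)=\mathrm{pc}_-^k(n)/2^k$, and $\mathrm{rpc}^k(n)=\mathrm{pc}^k(n)/2^k$.
   Context: A composition of $n$ is a finite sequence $\alpha=(\alpha_1,\ldots,\alpha_\ell)$ of positive integers with $\alpha_1+\cdots+\alpha_\ell=n$; the empty sequence ($\ell=0$) is the only composition of $0$. $\mathrm{pc}^k(n)$ is the number of compositions $\alpha=(\alpha_1,\ldots,\alpha_\ell)$ of $n$ such that $\#\{1\le i\le \ell/2:\alpha_i\ne\alpha_{\ell+1-i}\}=k$. Among these, $\mathrm{pc}_+^k(n)$ counts those with $\ell$ even or with $\ell$ odd and the middle part $\alpha_{(\ell+1)/2}$ even, and $\mathrm{pc}_-^k(n)$ counts those with $\ell$ odd and $\alpha_{(\ell+1)/2}$ odd. Two compositions of the same length $\ell$ are called equivalent if one is obtained from the other by a sequence of swaps, each swap exchanging the $i$th part and the $(\ell+1-i)$th part for some $1\le i\le\ell/2$. The numbers $\mathrm{rpc}^k(n)$, $\mathrm{rpc}_+^k(n)$, $\mathrm{rpc}_-^k(n)$ are the numbers of equivalence classes of the compositions counted by $\mathrm{pc}^k(n)$, $\mathrm{pc}_+^k(n)$, $\mathrm{pc}_-^k(n)$, respectively. *)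

theory Defs
  imports Complex_Main
begin

definition is_composition :: "nat list \<Rightarrow> bool" where
  "is_composition \<alpha> \<longleftrightarrow> (\<forall>a\<in>set \<alpha>. a > 0)"

definition compositions :: "nat \<Rightarrow> nat list set" where
  "compositions n = {\<alpha>. is_composition \<alpha> \<and> sum_list \<alpha> = n}"

text \<open>Parts are numbered from 1, whereas list indices start at 0.\<close>

definition part :: "nat list \<Rightarrow> nat \<Rightarrow> nat" where
  "part \<alpha> i = \<alpha> ! (i - 1)"

text \<open>The condition \<open>i \<le> \<ell> / 2\<close> is written \<open>2 * i \<le> \<ell>\<close>.\<close>

definition mismatches :: "nat list \<Rightarrow> nat" where
  "mismatches \<alpha> =
     card {i. 1 \<le> i \<and> 2 * i \<le> length \<alpha> \<and> part \<alpha> i \<noteq> part \<alpha> (length \<alpha> + 1 - i)}"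

definition middle_part :: "nat list \<Rightarrow> nat" where
  "middle_part \<alpha> = part \<alpha> ((length \<alpha> + 1) div 2)"

definition PC :: "nat \<Rightarrow> nat \<Rightarrow> nat list set" where
  "PC k n = {\<alpha> \<in> compositions n. mismatches \<alpha> = k}"

definition PC_plus :: "nat \<Rightarrow> nat \<Rightarrow> nat list set" where
  "PC_plus k n = {\<alpha> \<in> PC k n. even (length \<alpha>) \<or> (odd (length \<alpha>) \<and> even (middle_part \<alpha>))}"

definition PC_minus :: "nat \<Rightarrow> nat \<Rightarrow> nat list set" where
  "PC_minus k n = {\<alpha> \<in> PC k n. odd (length \<alpha>) \<and> odd (middle_part \<alpha>)}"

definition pc :: "nat \<Rightarrow> nat \<Rightarrow> nat" where
  "pc k n = card (PC k n)"

definition pc_plus :: "nat \<Rightarrow> nat \<Rightarrow> nat" where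
  "pc_plus k n = card (PC_plus k n)"

definition pc_minus :: "nat \<Rightarrow> nat \<Rightarrow> nat" where
  "pc_minus k n = card (PC_minus k n)"

definition swap_parts :: "nat \<Rightarrow> nat list \<Rightarrow> nat list" where
  "swap_parts i \<alpha> =
     \<alpha>[i - 1 := part \<alpha> (length \<alpha> + 1 - i), length \<alpha> - i := part \<alpha> i]"

definition swap_step :: "(nat list \<times> nat list) set" where
  "swap_step = {(\<alpha>, swap_parts i \<alpha>) | \<alpha> i. 1 \<le> i \<and> 2 * i \<le> length \<alpha>}"

definition swap_equiv :: "(nat list \<times> nat list) set" where
  "swap_equiv = {(\<alpha>, \<beta>). is_composition \<alpha> \<and> is_composition \<beta> \<and> (\<alpha>, \<beta>) \<in> swap_step\<^sup>*}"

definition rpc :: "nat \<Rightarrow> nat \<Rightarrow> nat" where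
  "rpc k n = card (PC k n // swap_equiv)"

definition rpc_plus :: "nat \<Rightarrow> nat \<Rightarrow> nat" where
  "rpc_plus k n = card (PC_plus k n // swap_equiv)"

definition rpc_minus :: "nat \<Rightarrow> nat \<Rightarrow> nat" where
  "rpc_minus k n = card (PC_minus k n // swap_equiv)"

text \<open>The sets being counted are finite and \<open>swap_equiv\<close> is an equivalence relation on
  compositions, so \<open>card\<close> and \<open>//\<close> have their intended meaning above.\<close>

lemma finite_compositions: "finite (compositions n)"
proof -
  have len: "length \<alpha> \<le> sum_list \<alpha>" if "is_composition \<alpha>" for \<alpha>
    using that unfolding is_composition_def by (induction \<alpha>) (auto simp: Suc_le_eq)
  have "compositions n \<subseteq> {\<alpha>. set \<alpha> \<subseteq> {..n} \<and> length \<alpha> \<le> n}"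
    using len member_le_sum_list by (fastforce simp: compositions_def)
  then show ?thesis
    by (rule finite_subset) (simp add: finite_lists_length_le)
qed

lemma swap_parts_swap_parts:
  assumes "1 \<le> i" "2 * i \<le> length \<alpha>"
  shows "swap_parts i (swap_parts i \<alpha>) = \<alpha>"
  using assms by (intro nth_equalityI) (auto simp: swap_parts_def part_def nth_list_update)

lemma equiv_swap_equiv: "equiv (Collect is_composition) swap_equiv"
proof -
  have "(swap_parts i \<alpha>, \<alpha>) \<in> swap_step" if "1 \<le> i" "2 * i \<le> length \<alpha>" for i \<alpha>
  proof -
    have "length (swap_parts i \<alpha>) = length \<alpha>" by (simp add: swap_parts_def)
    then show ?thesis
      using that swap_parts_swap_parts[OF that] unfolding swap_step_def
      by (metis (mono_tags, lifting) mem_Collect_eq)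
  qed
  then have "sym swap_step" by (auto simp: sym_def swap_step_def)
  then have "sym (swap_step\<^sup>*)" by (rule sym_rtrancl)
  then show ?thesis
    by (auto simp: equiv_def refl_on_def swap_equiv_def sym_def trans_def intro: rtrancl_trans)
qed

end

theory Submission
  imports Defs "HOL-Library.Multiset"
begin

text \<open>
  The pairs of mirror positions \<open>{i, \<ell> + 1 - i}\<close> are disjoint, so swaps at different pairs commute
  and each swap is an involution: a sequence of swaps does nothing more than exchange the two parts
  of every pair in some set \<open>S\<close> (\<open>swap_pairs S\<close>). Exchanging two equal parts changes nothing, so
  only the mismatched pairs in \<open>S\<close> matter, and exchanging those of two different sets of mismatched
  pairs gives different compositions. Hence the class of a composition with \<open>k\<close> mismatches is in
  bijection with the subsets of its \<open>k\<close>-element set of mismatches, and it has exactly \<open>2 ^ k\<close>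
  elements (\<open>card_swap_class\<close>).

  A swap permutes the parts, keeps every mismatched pair mismatched and every matched one matched,
  and never touches the middle part. The three families are therefore unions of classes, and since
  all classes in them have size \<open>2 ^ k\<close>, the number of classes is the number of members divided by
  \<open>2 ^ k\<close>.
\<close>

definition mismatch_set :: "nat list \<Rightarrow> nat set" where
  "mismatch_set \<alpha> =
     {i. 1 \<le> i \<and> 2 * i \<le> length \<alpha> \<and> part \<alpha> i \<noteq> part \<alpha> (length \<alpha> + 1 - i)}"

lemma mismatches_eq_card: "mismatches \<alpha> = card (mismatch_set \<alpha>)"
  by (simp add: mismatches_def mismatch_set_def)

lemma finite_mismatch_set: "finite (mismatch_set \<alpha>)"
  by (rule finite_subset[of _ "{..length \<alpha>}"]) (auto simp: mismatch_set_def)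

lemma length_swap_parts [simp]: "length (swap_parts i \<alpha>) = length \<alpha>"
  by (simp add: swap_parts_def)

lemma part_swap_parts:
  assumes "1 \<le> i" "2 * i \<le> length \<alpha>" "1 \<le> j" "j \<le> length \<alpha>"
  shows "part (swap_parts i \<alpha>) j =
    (if j = i \<or> j = length \<alpha> + 1 - i then part \<alpha> (length \<alpha> + 1 - j) else part \<alpha> j)"
proof -
  have idx: "i - 1 < length \<alpha>" "length \<alpha> - i < length \<alpha>" "i - 1 = j - 1 \<longleftrightarrow> j = i"
    "length \<alpha> - i = j - 1 \<longleftrightarrow> j = length \<alpha> + 1 - i"
    "length \<alpha> + 1 - (length \<alpha> + 1 - i) = i"
    using assms by auto
  have "part (swap_parts i \<alpha>) j = (if j = length \<alpha> + 1 - i then part \<alpha> i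
      else if j = i then part \<alpha> (length \<alpha> + 1 - i) else part \<alpha> j)"
    by (simp only: swap_parts_def Defs.part_def[of _ j] nth_list_update idx
        length_list_update)
  then show ?thesis using idx(5) assms(1,2) by (cases "j = length \<alpha> + 1 - i") simp_all
qed

lemma list_eq_by_parts:
  assumes "length \<alpha> = length \<beta>"
    and "\<And>j. 1 \<le> j \<Longrightarrow> j \<le> length \<alpha> \<Longrightarrow> part \<alpha> j = part \<beta> j"
  shows "\<alpha> = \<beta>"
proof (rule nth_equalityI)
  fix i assume "i < length \<alpha>"
  then show "\<alpha> ! i = \<beta> ! i" using assms(2)[of "Suc i"] by (simp add: Defs.part_def)
qed (rule assms(1))

lemma mset_swap_parts:
  assumes "1 \<le> i" "2 * i \<le> length \<alpha>"
  shows "mset (swap_parts i \<alpha>) = mset \<alpha>"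
proof -
  have "length \<alpha> + 1 - i - 1 = length \<alpha> - i" using assms by simp
  then show ?thesis
    using mset_swap[of "length \<alpha> - i" \<alpha> "i - 1"] assms
    by (simp add: swap_parts_def Defs.part_def)
qed

lemma swap_parts_in_compositions:
  assumes "1 \<le> i" "2 * i \<le> length \<alpha>" "\<alpha> \<in> compositions n"
  shows "swap_parts i \<alpha> \<in> compositions n"
proof -
  note perm = mset_swap_parts[OF assms(1,2)]
  have "set (swap_parts i \<alpha>) = set \<alpha>" using perm by (rule mset_eq_setD)
  moreover have "sum_list (swap_parts i \<alpha>) = sum_list \<alpha>"
    using perm by (metis sum_mset_sum_list)
  ultimately show ?thesis using assms(3) by (simp add: compositions_def is_composition_def)
qed

text \<open>A swap at \<open>i\<close> only exchanges the two sides of the comparison of the pair \<open>i\<close>.\<close>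

lemma mismatch_set_swap_parts:
  assumes "1 \<le> i" "2 * i \<le> length \<alpha>"
  shows "mismatch_set (swap_parts i \<alpha>) = mismatch_set \<alpha>"
proof -
  have "part (swap_parts i \<alpha>) j = part (swap_parts i \<alpha>) (length \<alpha> + 1 - j) \<longleftrightarrow>
      part \<alpha> j = part \<alpha> (length \<alpha> + 1 - j)"
    if j: "1 \<le> j" "2 * j \<le> length \<alpha>" for j
  proof -
    have "j \<le> length \<alpha>" "1 \<le> length \<alpha> + 1 - j" "length \<alpha> + 1 - j \<le> length \<alpha>"
      "length \<alpha> + 1 - (length \<alpha> + 1 - j) = j" "j \<noteq> length \<alpha> + 1 - i"
      "length \<alpha> + 1 - j = length \<alpha> + 1 - i \<longleftrightarrow> j = i" "length \<alpha> + 1 - j \<noteq> i"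
      using j assms by auto
    then show ?thesis
      using assms j by (auto simp: part_swap_parts simp del: One_nat_def)
  qed
  then show ?thesis unfolding mismatch_set_def length_swap_parts by blast
qed

lemma middle_part_swap_parts:
  assumes "1 \<le> i" "2 * i \<le> length \<alpha>" "odd (length \<alpha>)"
  shows "middle_part (swap_parts i \<alpha>) = middle_part \<alpha>"
proof -
  obtain m where m: "length \<alpha> = 2 * m + 1" using assms(3) by (rule oddE)
  have "part (swap_parts i \<alpha>) (m + 1) = part \<alpha> (m + 1)"
    using part_swap_parts[OF assms(1,2), of "m + 1"] assms(1,2) m by auto
  then show ?thesis by (simp add: middle_part_def m)
qed

lemma swap_parts_in_PC:
  assumes "1 \<le> i" "2 * i \<le> length \<alpha>" "\<alpha> \<in> PC k n"
  shows "swap_parts i \<alpha> \<in> PC k n"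
  using assms swap_parts_in_compositions
  by (simp add: PC_def mismatches_eq_card mismatch_set_swap_parts)

text \<open>
  The effect of an arbitrary sequence of swaps. The pair of the position \<open>j\<close> is named by its smaller
  member \<open>min j (\<ell> + 1 - j)\<close>. A middle position is its own mirror image, so it is left alone even
  if it is named in \<open>S\<close>.
\<close>

definition swap_pairs :: "nat set \<Rightarrow> nat list \<Rightarrow> nat list" where
  "swap_pairs S \<alpha> =
     map (\<lambda>j. if min j (length \<alpha> + 1 - j) \<in> S then part \<alpha> (length \<alpha> + 1 - j) else part \<alpha> j)
       [1..<length \<alpha> + 1]"

lemma length_swap_pairs [simp]: "length (swap_pairs S \<alpha>) = length \<alpha>"
  by (simp add: swap_pairs_def del: upt_Suc)

lemma part_swap_pairs:
  assumes "1 \<le> j" "j \<le> length \<alpha>"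
  shows "part (swap_pairs S \<alpha>) j =
    (if min j (length \<alpha> + 1 - j) \<in> S then part \<alpha> (length \<alpha> + 1 - j) else part \<alpha> j)"
proof -
  have "[1..<length \<alpha> + 1] ! (j - 1) = j" using assms by (subst nth_upt) auto
  then show ?thesis
    using assms by (simp add: swap_pairs_def Defs.part_def[of "map _ _"] del: upt_Suc)
qed

lemma swap_pairs_empty: "swap_pairs {} \<alpha> = \<alpha>"
  by (rule list_eq_by_parts) (simp_all add: part_swap_pairs)

text \<open>
  A further swap toggles the membership of its pair in the set of exchanged pairs, because swaps at
  other pairs do not interfere with it and swapping twice undoes the swap.
\<close>

lemma swap_parts_swap_pairs:
  assumes "1 \<le> i" "2 * i \<le> length \<alpha>"
  shows "swap_parts i (swap_pairs S \<alpha>) = swap_pairs ((S - {i}) \<union> ({i} - S)) \<alpha>"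
proof (rule list_eq_by_parts)
  fix j assume "1 \<le> j" "j \<le> length (swap_parts i (swap_pairs S \<alpha>))"
  then have j: "1 \<le> j" "j \<le> length \<alpha>" by simp_all
  have mirror: "1 \<le> length \<alpha> + 1 - j" "length \<alpha> + 1 - j \<le> length \<alpha>"
    "length \<alpha> + 1 - (length \<alpha> + 1 - j) = j"
    using j by auto
  have "j = i \<or> j = length \<alpha> + 1 - i \<longleftrightarrow> min j (length \<alpha> + 1 - j) = i"
    using j assms by auto
  then show "part (swap_parts i (swap_pairs S \<alpha>)) j =
      part (swap_pairs ((S - {i}) \<union> ({i} - S)) \<alpha>) j"
    using assms j mirror
    by (simp add: part_swap_parts part_swap_pairs min.commute del: One_nat_def)
qed simp

text \<open>Exchanging the two parts of a matched pair changes nothing.\<close>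

lemma swap_pairs_Int_mismatch_set: "swap_pairs (S \<inter> mismatch_set \<alpha>) \<alpha> = swap_pairs S \<alpha>"
proof (rule list_eq_by_parts)
  fix j assume "1 \<le> j" "j \<le> length (swap_pairs (S \<inter> mismatch_set \<alpha>) \<alpha>)"
  then have j: "1 \<le> j" "j \<le> length \<alpha>" by simp_all
  have "part \<alpha> (length \<alpha> + 1 - j) = part \<alpha> j"
    if "min j (length \<alpha> + 1 - j) \<notin> mismatch_set \<alpha>"
  proof -
    consider "2 * j \<le> length \<alpha>" | "2 * j = length \<alpha> + 1" | "length \<alpha> + 1 < 2 * j" by linarith
    then show ?thesis
    proof cases
      case 1
      then show ?thesis using that j by (simp add: mismatch_set_def min_def split: if_splits)
    next
      case 2
      then have "length \<alpha> + 1 - j = j" by simp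
      then show ?thesis by simp
    next
      case 3
      then have "min j (length \<alpha> + 1 - j) = length \<alpha> + 1 - j" "1 \<le> length \<alpha> + 1 - j"
        "2 * (length \<alpha> + 1 - j) \<le> length \<alpha>" "length \<alpha> + 1 - (length \<alpha> + 1 - j) = j"
        using j by auto
      then show ?thesis using that by (simp add: mismatch_set_def del: One_nat_def)
    qed
  qed
  then show "part (swap_pairs (S \<inter> mismatch_set \<alpha>) \<alpha>) j = part (swap_pairs S \<alpha>) j"
    using j by (auto simp: part_swap_pairs)
qed simp

text \<open>The part at a mismatched position reveals whether its pair has been exchanged.\<close>

lemma inj_on_swap_pairs: "inj_on (\<lambda>S. swap_pairs S \<alpha>) (Pow (mismatch_set \<alpha>))"
proof (rule inj_on_inverseI)
  fix S assume S: "S \<in> Pow (mismatch_set \<alpha>)"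
  have "part (swap_pairs S \<alpha>) i \<noteq> part \<alpha> i \<longleftrightarrow> i \<in> S" if "i \<in> mismatch_set \<alpha>" for i
  proof -
    have "1 \<le> i" "i \<le> length \<alpha>" "min i (length \<alpha> + 1 - i) = i"
      "part \<alpha> i \<noteq> part \<alpha> (length \<alpha> + 1 - i)"
      using that by (auto simp: mismatch_set_def)
    then show ?thesis by (simp add: part_swap_pairs del: One_nat_def)
  qed
  then show "{i \<in> mismatch_set \<alpha>. part (swap_pairs S \<alpha>) i \<noteq> part \<alpha> i} = S"
    using S by auto
qed

lemma swap_steps_imp_swap_pairs:
  assumes "(\<alpha>, \<beta>) \<in> swap_step\<^sup>*"
  shows "\<exists>S. \<beta> = swap_pairs S \<alpha>"
  using assms
proof (induction rule: rtrancl_induct)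
  case base
  show ?case using swap_pairs_empty by metis
next
  case (step \<beta> \<gamma>)
  then obtain S where S: "\<beta> = swap_pairs S \<alpha>" by blast
  obtain i where "1 \<le> i" "2 * i \<le> length \<beta>" "\<gamma> = swap_parts i \<beta>"
    using step.hyps(2) by (auto simp: swap_step_def)
  then show ?case using swap_parts_swap_pairs[of i \<alpha> S] S by auto
qed

lemma swap_pairs_reachable:
  assumes "finite S" "S \<subseteq> mismatch_set \<alpha>"
  shows "(\<alpha>, swap_pairs S \<alpha>) \<in> swap_step\<^sup>*"
  using assms
proof (induction rule: finite_induct)
  case empty
  show ?case by (simp add: swap_pairs_empty)
next
  case (insert i S)
  then have i: "1 \<le> i" "2 * i \<le> length \<alpha>" by (auto simp: mismatch_set_def)
  have "(S - {i}) \<union> ({i} - S) = insert i S" using insert.hyps(2) by auto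
  then have "swap_parts i (swap_pairs S \<alpha>) = swap_pairs (insert i S) \<alpha>"
    using swap_parts_swap_pairs[OF i, of S] by simp
  then have "(swap_pairs S \<alpha>, swap_pairs (insert i S) \<alpha>) \<in> swap_step"
    using i unfolding swap_step_def by (smt (verit) length_swap_pairs mem_Collect_eq)
  then show ?case using insert by (meson insert_subset rtrancl.rtrancl_into_rtrancl)
qed

lemma reachable_from_eq:
  "swap_step\<^sup>* `` {\<alpha>} = (\<lambda>S. swap_pairs S \<alpha>) ` Pow (mismatch_set \<alpha>)"
proof
  show "swap_step\<^sup>* `` {\<alpha>} \<subseteq> (\<lambda>S. swap_pairs S \<alpha>) ` Pow (mismatch_set \<alpha>)"
  proof
    fix \<beta> assume "\<beta> \<in> swap_step\<^sup>* `` {\<alpha>}"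
    then obtain S where "\<beta> = swap_pairs S \<alpha>" using swap_steps_imp_swap_pairs by auto
    then have "\<beta> = swap_pairs (S \<inter> mismatch_set \<alpha>) \<alpha>" by (simp add: swap_pairs_Int_mismatch_set)
    then show "\<beta> \<in> (\<lambda>S. swap_pairs S \<alpha>) ` Pow (mismatch_set \<alpha>)" by blast
  qed
  show "(\<lambda>S. swap_pairs S \<alpha>) ` Pow (mismatch_set \<alpha>) \<subseteq> swap_step\<^sup>* `` {\<alpha>}"
    using swap_pairs_reachable finite_subset[OF _ finite_mismatch_set] by auto
qed

lemma reachable_in_closed_set:
  assumes closed: "\<And>\<alpha> i. \<alpha> \<in> A \<Longrightarrow> 1 \<le> i \<Longrightarrow> 2 * i \<le> length \<alpha> \<Longrightarrow> swap_parts i \<alpha> \<in> A"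
    and "(\<alpha>, \<beta>) \<in> swap_step\<^sup>*" "\<alpha> \<in> A"
  shows "\<beta> \<in> A"
  using assms(2,3) by (induction rule: rtrancl_induct) (auto simp: swap_step_def intro: closed)

lemma card_swap_class:
  assumes "is_composition \<alpha>"
  shows "card (swap_equiv `` {\<alpha>}) = 2 ^ mismatches \<alpha>"
proof -
  have "is_composition \<beta>" if "(\<alpha>, \<beta>) \<in> swap_step\<^sup>*" for \<beta>
    using reachable_in_closed_set[of "compositions (sum_list \<alpha>)", OF _ that] assms
      swap_parts_in_compositions
    by (auto simp: compositions_def)
  then have "swap_equiv `` {\<alpha>} = swap_step\<^sup>* `` {\<alpha>}"
    using assms by (auto simp: swap_equiv_def)
  then show ?thesis
    by (simp add: reachable_from_eq card_image[OF inj_on_swap_pairs] card_Pow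
        finite_mismatch_set mismatches_eq_card)
qed

text \<open>
  A set closed under swaps is a disjoint union of whole classes, and these all have \<open>2 ^ k\<close> members
  because \<open>k\<close> is the number of mismatches throughout the set.
\<close>

lemma card_quotient_of_swap_closed:
  assumes sub: "A \<subseteq> PC k n"
    and closed: "\<And>\<alpha> i. \<alpha> \<in> A \<Longrightarrow> 1 \<le> i \<Longrightarrow> 2 * i \<le> length \<alpha> \<Longrightarrow> swap_parts i \<alpha> \<in> A"
  shows "real (card (A // swap_equiv)) = real (card A) / 2 ^ k"
proof -
  have comp: "is_composition \<alpha>" "mismatches \<alpha> = k" if "\<alpha> \<in> A" for \<alpha>
    using sub that by (auto simp: PC_def compositions_def)
  have "finite A"
    using sub by (rule finite_subset)
      (auto simp: PC_def intro: finite_subset[OF _ finite_compositions[of n]])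
  have union: "\<Union> (A // swap_equiv) = A"
  proof
    show "\<Union> (A // swap_equiv) \<subseteq> A"
      using reachable_in_closed_set[OF closed] by (fastforce simp: quotient_def swap_equiv_def)
    show "A \<subseteq> \<Union> (A // swap_equiv)"
      using comp(1) by (auto simp: quotient_def swap_equiv_def)
  qed
  have "A // swap_equiv \<subseteq> Collect is_composition // swap_equiv"
    using comp(1) by (auto simp: quotient_def)
  then have "c1 \<inter> c2 = {}" if "c1 \<in> A // swap_equiv" "c2 \<in> A // swap_equiv" "c1 \<noteq> c2" for c1 c2
    using quotient_disj[OF equiv_swap_equiv] that by blast
  moreover have "card c = 2 ^ k" if "c \<in> A // swap_equiv" for c
    using that comp card_swap_class by (auto simp: quotient_def)
  moreover have "finite (A // swap_equiv)"
    using \<open>finite A\<close> by (simp add: quotient_def)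
  ultimately have "2 ^ k * card (A // swap_equiv) = card A"
    using card_partition[of "A // swap_equiv" "2 ^ k"] \<open>finite A\<close> by (simp add: union)
  then have "real (card A) = 2 ^ k * real (card (A // swap_equiv))"
    by (metis of_nat_mult of_nat_numeral of_nat_power)
  then show ?thesis by simp
qed

theorem proposition3p1:
  fixes n k :: nat
  shows "real (rpc_plus k n) = real (pc_plus k n) / 2 ^ k
    \<and> real (rpc_minus k n) = real (pc_minus k n) / 2 ^ k
    \<and> real (rpc k n) = real (pc k n) / 2 ^ k"
proof (intro conjI)
  show "real (rpc_plus k n) = real (pc_plus k n) / 2 ^ k"
    unfolding rpc_plus_def pc_plus_def
    by (rule card_quotient_of_swap_closed[of _ k n])
      (auto simp: PC_plus_def middle_part_swap_parts swap_parts_in_PC)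
  show "real (rpc_minus k n) = real (pc_minus k n) / 2 ^ k"
    unfolding rpc_minus_def pc_minus_def
    by (rule card_quotient_of_swap_closed[of _ k n])
      (auto simp: PC_minus_def middle_part_swap_parts swap_parts_in_PC)
  show "real (rpc k n) = real (pc k n) / 2 ^ k"
    unfolding rpc_def pc_def
    by (rule card_quotient_of_swap_closed[of _ k n]) (auto simp: swap_parts_in_PC)
qed

end
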